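(* Let $\Omega\subset\mathbb{R}^n$ be compact and convex, $f\in C^1(\Omega)$ with $L$-Lipschitz gradient on $\Omega$ ($L>0$), and let $\mathcal{A}$ be a method satisfying the angle condition $\mathrm{SB}_{\mathcal A}(\Omega)=\tau>0$. Let $\{x_k\}$ be an infinite sequence generated by the first-order method with directions $d_k\in\mathcal{A}(x_k,-\nabla f(x_k))$ and stepsize $\alpha_k=\min(\bar\alpha_k,\alpha_k^{\max})$, $\bar\alpha_k=\frac{\langle-\nabla f(x_k),d_k\rangle}{L\|d_k\|^2}$. Assume that the number of bad steps between two consecutive good steps is bounded (there are infinitely many good steps, at iterations $k(0)<k(1)<\dots$, and $k(j+1)-k(j)$ is bounded). Then: (i) every accumulation point of $\{x_k\}$ is stationary, and $f(x_k)$ is decreasing and convergent to some $f^*\in\mathbb{R}$; (ii) if $\mu>0$ and the KL condition with constant $\mu$ holds at every stationary point in the level set $\{x\in\Omega: f(x)=f^*\}$, then there is $M>0$ such that for all $k$ $$f(x_k)-f^*\le M\,\bar q^{\,\bar\gamma(k)},\qquad \bar q=\max\left(\left(1+\frac{\mu}{L}\right)^{-1},\ 1-\frac{\mu}{L}\tau^2\right),$$ where $\bar\gamma(k)$ is the number of good steps among the first $k$ steps.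
   Context: $\|\cdot\|$ is the Euclidean norm. $f\in C^1(\Omega)$ means continuously differentiable on an open set containing $\Omega$; the Lipschitz condition is $\|\nabla f(x)-\nabla f(y)\|\le L\|x-y\|$ for $x,y\in\Omega$. For $x\in\Omega$, $T_\Omega(x)=\mathrm{cl}\{w:\exists\lambda>0,\ x+\lambda w\in\Omega\}$ is the tangent cone, $\pi(C,\cdot)$ the Euclidean projection on a closed convex set $C$, and $\pi_x(g)=\|\pi(T_\Omega(x),g)\|$. A point $x$ is stationary if $\pi_x(-\nabla f(x))=0$. KL condition with constant $\mu$ at a stationary point $x^*$: there exist $\eta,\delta>0$ such that $\pi_x(-\nabla f(x))\ge\sqrt{2\mu}\,(f(x)-f(x^* ))^{1/2}$ for every $x\in\Omega$ with $\|x-x^*\|<\delta$ and $f(x^* )<f(x)<f(x^* )+\eta$. A method $\mathcal{A}$ assigns to every $(x,g)\in\Omega\times\mathbb{R}^n$ a set $\mathcal{A}(x,g)\subset (T_\Omega(x)\cap\{d:\langle g,d\rangle>0\})\cup\{0\}$ of feasible directions at $x$, with $\mathcal{A}(x,g)=\{0\}$ if $\pi_x(g)=0$ and $0\notin\mathcal{A}(x,g)\ne\emptyset$ otherwise. $\mathrm{DSB}_{\mathcal A}(\Omega,x,g)=\inf_{d\in\mathcal{A}(x,g)}\frac{\langle g,d\rangle}{\pi_x(g)\|d\|}$ if $\pi_x(g)\neq0$, and $=1$ if $\pi_x(g)=0$; $\mathrm{SB}_{\mathcal A}(\Omega)=\inf_{x\in\Omega,g\in\mathbb{R}^n}\mathrm{DSB}_{\mathcal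 A}(\Omega,x,g)$. First-order method: start from $x_0\in\Omega$; at iteration $k$, stop if $x_k$ is stationary; otherwise choose $d_k\in\mathcal{A}(x_k,-\nabla f(x_k))$ and set $x_{k+1}=x_k+\alpha_kd_k$, where $\alpha_k^{\max}>0$ is such that $x_k+\alpha d_k\in\Omega$ for all $\alpha\in[0,\alpha_k^{\max}]$. Step $k$ is good if $\alpha_k=\bar\alpha_k$ or if it is a full FW step, i.e. $x_{k+1}\in\arg\min_{x\in\Omega}\langle\nabla f(x_k),x\rangle$; otherwise it is bad. *)

theory Defs
  imports "HOL-Analysis.Analysis"
begin

definition gradient :: "('a::euclidean_space \<Rightarrow> real) \<Rightarrow> 'a \<Rightarrow> 'a" where
  "gradient f x = (THE v. GDERIV f x :> v)"

lemma gradient_eqI: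
  assumes "GDERIV f x :> v"
  shows "gradient f x = v"
proof -
  have "w = v" if "GDERIV f x :> w" for w
  proof -
    have "(\<lambda>h. h \<bullet> w) = (\<lambda>h. h \<bullet> v)"
      using that assms unfolding gderiv_def by (rule has_derivative_unique)
    then have "\<forall>h. h \<bullet> w = h \<bullet> v"
      by (rule fun_cong[THEN allI])
    then show ?thesis
      by (simp only: vector_eq_ldot)
  qed
  then show ?thesis
    unfolding gradient_def by (rule the_equality[where P = "\<lambda>v. GDERIV f x :> v", OF assms])
qed

lemma GDERIV_gradient:
  assumes "f differentiable (at x)"
  shows "GDERIV f x :> gradient f x"
proof -
  obtain D where D: "(f has_derivative D) (at x)"
    using assms unfolding differentiable_def by blast
  then have lin: "linear D"
    by (rule has_derivative_linear)
  have eq: "(\<lambda>h. h \<bullet> adjoint D 1) = D"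
    by (rule ext) (simp add: adjoint_works[OF lin])
  have gd: "GDERIV f x :> adjoint D 1"
    unfolding gderiv_def eq by (rule D)
  show ?thesis
    unfolding gradient_eqI[OF gd] by (rule gd)
qed

definition C1_on :: "'a::euclidean_space set \<Rightarrow> ('a \<Rightarrow> real) \<Rightarrow> bool" where
  "C1_on \<Omega> f \<longleftrightarrow> (\<exists>U. open U \<and> \<Omega> \<subseteq> U \<and>
     (\<forall>x\<in>U. f differentiable (at x)) \<and> continuous_on U (gradient f))"

definition feasible_directions :: "'a::euclidean_space set \<Rightarrow> 'a \<Rightarrow> 'a set" where
  "feasible_directions \<Omega> x = {w. \<exists>l>0. x + l *\<^sub>R w \<in> \<Omega>}"

definition tangent_cone :: "'a::euclidean_space set \<Rightarrow> 'a \<Rightarrow> 'a set" where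
  "tangent_cone \<Omega> x = closure (feasible_directions \<Omega> x)"

definition proj_norm :: "'a::euclidean_space set \<Rightarrow> 'a \<Rightarrow> 'a \<Rightarrow> real" where
  "proj_norm \<Omega> x g = norm (closest_point (tangent_cone \<Omega> x) g)"

definition stationary :: "'a::euclidean_space set \<Rightarrow> ('a \<Rightarrow> real) \<Rightarrow> 'a \<Rightarrow> bool" where
  "stationary \<Omega> f x \<longleftrightarrow> x \<in> \<Omega> \<and> proj_norm \<Omega> x (- gradient f x) = 0"

definition KL_at :: "'a::euclidean_space set \<Rightarrow> ('a \<Rightarrow> real) \<Rightarrow> real \<Rightarrow> 'a \<Rightarrow> bool" where
  "KL_at \<Omega> f \<mu> p \<longleftrightarrow> (\<exists>\<eta>>0. \<exists>\<delta>>0. \<forall>x\<in>\<Omega>.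
     norm (x - p) < \<delta> \<and> f p < f x \<and> f x < f p + \<eta> \<longrightarrow>
     proj_norm \<Omega> x (- gradient f x) \<ge> sqrt (2 * \<mu>) * sqrt (f x - f p))"

definition direction_method :: "'a::euclidean_space set \<Rightarrow> ('a \<Rightarrow> 'a \<Rightarrow> 'a set) \<Rightarrow> bool" where
  "direction_method \<Omega> \<A> \<longleftrightarrow> (\<forall>x\<in>\<Omega>. \<forall>g.
     \<A> x g \<subseteq> feasible_directions \<Omega> x \<and>
     \<A> x g \<subseteq> (tangent_cone \<Omega> x \<inter> {d. g \<bullet> d > 0}) \<union> {0} \<and>
     (if proj_norm \<Omega> x g = 0 then \<A> x g = {0} else 0 \<notin> \<A> x g \<and> \<A> x g \<noteq> {}))"

text \<open>For a method in the above sense and nonempty \<open>\<Omega>\<close>, the infima below are taken over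
  nonempty sets of reals bounded below by 0, so the conditionally complete infimum on
  \<open>real\<close> is the intended one.\<close>

definition DSB ::
  "('a::euclidean_space \<Rightarrow> 'a \<Rightarrow> 'a set) \<Rightarrow> 'a set \<Rightarrow> 'a \<Rightarrow> 'a \<Rightarrow> real" where
  "DSB \<A> \<Omega> x g =
     (if proj_norm \<Omega> x g \<noteq> 0
      then (INF d\<in>\<A> x g. (g \<bullet> d) / (proj_norm \<Omega> x g * norm d))
      else 1)"

definition SB :: "('a::euclidean_space \<Rightarrow> 'a \<Rightarrow> 'a set) \<Rightarrow> 'a set \<Rightarrow> real" where
  "SB \<A> \<Omega> = (INF (x, g)\<in>\<Omega> \<times> UNIV. DSB \<A> \<Omega> x g)"

definition step_bar :: "('a::euclidean_space \<Rightarrow> real) \<Rightarrow> real \<Rightarrow> 'a \<Rightarrow> 'a \<Rightarrow> real" where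
  "step_bar f L x d = (- gradient f x \<bullet> d) / (L * (norm d)\<^sup>2)"

text \<open>An infinite run of the first-order method: since the method stops at stationary points,
  no iterate of such a run is stationary. The number \<open>amax k\<close> is any positive
  admissible upper bound for the stepsize, not necessarily the largest one.\<close>

definition first_order_run ::
  "'a::euclidean_space set \<Rightarrow> ('a \<Rightarrow> real) \<Rightarrow> ('a \<Rightarrow> 'a \<Rightarrow> 'a set) \<Rightarrow>
   (nat \<Rightarrow> 'a) \<Rightarrow> (nat \<Rightarrow> 'a) \<Rightarrow> (nat \<Rightarrow> real) \<Rightarrow> (nat \<Rightarrow> real) \<Rightarrow> bool" where
  "first_order_run \<Omega> f \<A> x d \<alpha> amax \<longleftrightarrow> x 0 \<in> \<Omega> \<and>
     (\<forall>k. \<not> stationary \<Omega> f (x k) \<and>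
          d k \<in> \<A> (x k) (- gradient f (x k)) \<and>
          amax k > 0 \<and> (\<forall>a\<in>{0..amax k}. x k + a *\<^sub>R d k \<in> \<Omega>) \<and>
          x (Suc k) = x k + \<alpha> k *\<^sub>R d k)"

text \<open>Step \<open>k\<close> leads from \<open>x k\<close> to \<open>x (Suc k)\<close>; the second
  disjunct describes a full Frank-Wolfe step.\<close>

definition good_step ::
  "'a::euclidean_space set \<Rightarrow> ('a \<Rightarrow> real) \<Rightarrow> real \<Rightarrow>
   (nat \<Rightarrow> 'a) \<Rightarrow> (nat \<Rightarrow> 'a) \<Rightarrow> (nat \<Rightarrow> real) \<Rightarrow> nat \<Rightarrow> bool" where
  "good_step \<Omega> f L x d \<alpha> k \<longleftrightarrow>
     \<alpha> k = step_bar f L (x k) (d k) \<or>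
     is_arg_min (\<lambda>y. gradient f (x k) \<bullet> y) (\<lambda>y. y \<in> \<Omega>) (x (Suc k))"

text \<open>\<open>enumerate S j\<close> is the \<open>j\<close>-th element, in increasing order, of the infinite set
  \<open>S\<close> of good steps.\<close>

definition bounded_gaps :: "nat set \<Rightarrow> bool" where
  "bounded_gaps S \<longleftrightarrow>
     infinite S \<and> (\<exists>B. \<forall>j. enumerate S (Suc j) - enumerate S j \<le> B)"

definition num_good ::
  "'a::euclidean_space set \<Rightarrow> ('a \<Rightarrow> real) \<Rightarrow> real \<Rightarrow>
   (nat \<Rightarrow> 'a) \<Rightarrow> (nat \<Rightarrow> 'a) \<Rightarrow> (nat \<Rightarrow> real) \<Rightarrow> nat \<Rightarrow> nat" where
  "num_good \<Omega> f L x d \<alpha> k = card {i. i < k \<and> good_step \<Omega> f L x d \<alpha> i}"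

end

theory Submission
  imports Defs
begin

text \<open>
  Write \<open>g = - \<nabla>f\<close> and \<open>\<pi>\<^sub>x\<close> for the norm of the projection of \<open>g x\<close> onto the tangent cone
  at \<open>x\<close>. The proof rests on two inequalities. A step no longer than \<open>step_bar\<close> satisfies both
  \<open>f (x k) - f (x (Suc k)) \<ge> \<alpha>\<^sub>k / 2 * (g \<bullet> d\<^sub>k)\<close> and
  \<open>f (x k) - f (x (Suc k)) \<ge> L / 2 * \<parallel>x (Suc k) - x k\<parallel>\<^sup>2\<close>, by the descent lemma for functions with
  Lipschitz gradient. On a good step this decrease controls \<open>\<pi>\<close> at one end of the step.
  If the stepsize is \<open>step_bar\<close>, the first inequality and the angle condition give a decrease of
  at least \<open>\<tau>\<^sup>2 \<pi>\<^sup>2 / (2 L)\<close> with \<open>\<pi>\<close> taken at the starting point. If the step is a full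
  Frank-Wolfe step, then \<open>g (x k)\<close> lies in the normal cone at the endpoint, so Moreau's
  decomposition bounds \<open>\<pi>\<close> there by
  \<open>\<parallel>g (x (Suc k)) - g (x k)\<parallel> \<le> L \<parallel>x (Suc k) - x k\<parallel>\<close>, and the second inequality gives a
  decrease of at least \<open>\<pi>\<^sup>2 / (2 L)\<close> with \<open>\<pi>\<close> taken at the endpoint.

  Since \<open>f\<close> is bounded below on the compact set \<open>\<Omega>\<close>, the decreases and hence the displacements tend
  to zero. Every iterate has a good step within a bounded number of iterations, so near it there is
  an iterate with small \<open>\<pi>\<close>. The inequality \<open>g y \<bullet> (z - y) \<le> \<pi>\<^sub>y \<parallel>z - y\<parallel>\<close> passes
  to the limit and shows that accumulation points are stationary.

  By compactness all late iterates fall under the KL condition: a subsequence of violators would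
  accumulate at a stationary point \<open>p\<close> with \<open>f p = f\<^sup>*\<close>, where KL holds by assumption. With KL, a
  good step of length \<open>step_bar\<close> multiplies the gap \<open>f (x k) - f\<^sup>*\<close> by at most
  \<open>1 - \<mu> / L * \<tau>\<^sup>2\<close>, and a full Frank-Wolfe step, where KL is used at the endpoint, divides it by
  at least \<open>1 + \<mu> / L\<close>. Bad steps do not increase the gap.
\<close>

section \<open>Projection onto the tangent cone\<close>

lemma convex_cone_feasible_directions:
  fixes \<Omega> :: "'a::euclidean_space set"
  assumes "convex \<Omega>" "x \<in> \<Omega>"
  shows "convex_cone (feasible_directions \<Omega> x)"
proof -
  have zero: "0 \<in> feasible_directions \<Omega> x"
    using assms(2) by (auto simp: feasible_directions_def intro: exI[of _ 1])
  have add: "v + w \<in> feasible_directions \<Omega> x"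
    if v: "v \<in> feasible_directions \<Omega> x" and w: "w \<in> feasible_directions \<Omega> x" for v w
  proof -
    obtain l m where l: "l > 0" "x + l *\<^sub>R v \<in> \<Omega>" and m: "m > 0" "x + m *\<^sub>R w \<in> \<Omega>"
      using v w by (auto simp: feasible_directions_def)
    \<comment> \<open>The harmonic stepsize turns the sum of the two directions into a convex combination.\<close>
    have "(m / (l + m)) *\<^sub>R (x + l *\<^sub>R v) + (l / (l + m)) *\<^sub>R (x + m *\<^sub>R w) \<in> \<Omega>"
      using l m by (intro convexD[OF assms(1)]) (auto simp: add_divide_distrib[symmetric])
    moreover have "(m / (l + m)) *\<^sub>R (x + l *\<^sub>R v) + (l / (l + m)) *\<^sub>R (x + m *\<^sub>R w)
        = (m / (l + m) + l / (l + m)) *\<^sub>R x + (l * m / (l + m)) *\<^sub>R (v + w)"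
      by (simp add: algebra_simps)
    moreover have "m / (l + m) + l / (l + m) = 1"
      using l m by (simp add: add_divide_distrib[symmetric])
    ultimately have "x + (l * m / (l + m)) *\<^sub>R (v + w) \<in> \<Omega>"
      by simp
    moreover have "l * m / (l + m) > 0"
      using l m by simp
    ultimately show ?thesis
      unfolding feasible_directions_def by blast
  qed
  have scale: "c *\<^sub>R v \<in> feasible_directions \<Omega> x"
    if v: "v \<in> feasible_directions \<Omega> x" and c: "c \<ge> 0" for v and c :: real
  proof (cases "c = 0")
    case True
    then show ?thesis using zero by simp
  next
    case False
    obtain l where l: "l > 0" "x + l *\<^sub>R v \<in> \<Omega>"
      using v by (auto simp: feasible_directions_def)
    have "x + (l / c) *\<^sub>R (c *\<^sub>R v) \<in> \<Omega>" "l / c > 0"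
      using l c False by auto
    then show ?thesis
      unfolding feasible_directions_def by blast
  qed
  show ?thesis
    unfolding convex_cone_iff using zero add scale by blast
qed

lemma convex_cone_closure:
  fixes S :: "'a::real_normed_vector set"
  assumes "convex_cone S"
  shows "convex_cone (closure S)"
  unfolding convex_cone_def
proof (intro conjI)
  show "closure S \<noteq> {}" "convex (closure S)"
    using assms by (auto simp: convex_cone_def convex_closure)
  show "conic (closure S)"
    unfolding conic_def
  proof (intro allI impI)
    fix v :: 'a and c :: real
    assume v: "v \<in> closure S" and c: "0 \<le> c"
    obtain s where s: "\<And>n. s n \<in> S" "s \<longlonglongrightarrow> v"
      using v by (auto simp: closure_sequential)
    have "\<And>n. c *\<^sub>R s n \<in> S" "(\<lambda>n. c *\<^sub>R s n) \<longlonglongrightarrow> c *\<^sub>R v"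
      using s c assms by (auto intro: convex_cone_scaleR tendsto_intros)
    then show "c *\<^sub>R v \<in> closure S"
      unfolding closure_sequential by (intro exI[of _ "\<lambda>n. c *\<^sub>R s n"]) simp
  qed
qed

lemma convex_cone_tangent_cone:
  assumes "convex \<Omega>" "x \<in> \<Omega>"
  shows "convex_cone (tangent_cone \<Omega> x)"
  unfolding tangent_cone_def
  using convex_cone_closure[OF convex_cone_feasible_directions[OF assms]] .

lemma diff_mem_tangent_cone:
  assumes "z \<in> \<Omega>"
  shows "z - x \<in> tangent_cone \<Omega> x"
proof -
  have "z - x \<in> feasible_directions \<Omega> x"
    using assms by (auto simp: feasible_directions_def intro!: exI[of _ 1])
  then show ?thesis
    unfolding tangent_cone_def using closure_subset by blast
qed

text \<open>Moreau's decomposition of \<open>g\<close> along a closed convex cone: the remainder is orthogonal to the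
  projection \<open>P\<close> because the cone contains both \<open>0\<close> and \<open>2 P\<close>.\<close>

lemma closest_point_convex_cone:
  fixes C :: "'a::euclidean_space set"
  assumes "convex_cone C" "closed C"
  shows "(g - closest_point C g) \<bullet> closest_point C g = 0"
    and "w \<in> C \<Longrightarrow> (g - closest_point C g) \<bullet> w \<le> 0"
proof -
  let ?P = "closest_point C g"
  have ne: "C \<noteq> {}" and cv: "convex C"
    using assms(1) by (auto simp: convex_cone_def)
  have P: "?P \<in> C"
    using closest_point_in_set[OF assms(2) ne] .
  have dot: "(g - ?P) \<bullet> (w - ?P) \<le> 0" if "w \<in> C" for w
    using closest_point_dot[OF cv assms(2) that] .
  have "2 *\<^sub>R ?P \<in> C"
    using convex_cone_scaleR[OF assms(1) _ P, of 2] by simp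
  moreover have "0 \<in> C"
    using convex_cone_scaleR[OF assms(1) _ P, of 0] by simp
  ultimately show orth: "(g - ?P) \<bullet> ?P = 0"
    using dot[of 0] dot[of "2 *\<^sub>R ?P"] by (simp add: inner_diff_right)
  show "(g - ?P) \<bullet> w \<le> 0" if "w \<in> C"
    using dot[OF that] orth by (simp add: inner_diff_right)
qed

lemma inner_le_proj_norm:
  fixes \<Omega> :: "'a::euclidean_space set"
  assumes "convex \<Omega>" "x \<in> \<Omega>" "w \<in> tangent_cone \<Omega> x"
  shows "g \<bullet> w \<le> proj_norm \<Omega> x g * norm w"
proof -
  let ?P = "closest_point (tangent_cone \<Omega> x) g"
  have "(g - ?P) \<bullet> w \<le> 0"
    by (rule closest_point_convex_cone(2)[OF convex_cone_tangent_cone[OF assms(1,2)] _ assms(3)])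
      (simp add: tangent_cone_def)
  then have "g \<bullet> w \<le> ?P \<bullet> w"
    by (simp add: inner_diff_left)
  also have "\<dots> \<le> norm ?P * norm w"
    by (rule norm_cauchy_schwarz)
  finally show ?thesis
    by (simp add: proj_norm_def)
qed

text \<open>The norm of the projection is the distance of \<open>g\<close> from the normal cone, hence at most the
  distance to any normal vector \<open>v\<close>. Finding one normal vector close to \<open>g\<close> thus suffices to bound it.\<close>

lemma proj_norm_le_dist_normal:
  fixes \<Omega> :: "'a::euclidean_space set"
  assumes cv: "convex \<Omega>" and x: "x \<in> \<Omega>" and normal: "\<And>z. z \<in> \<Omega> \<Longrightarrow> v \<bullet> (z - x) \<le> 0"
  shows "proj_norm \<Omega> x g \<le> norm (g - v)"
proof -
  let ?T = "tangent_cone \<Omega> x"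
  let ?P = "closest_point ?T g"
  have T: "convex_cone ?T" "closed ?T"
    using convex_cone_tangent_cone[OF cv x] by (simp_all add: tangent_cone_def)
  have "feasible_directions \<Omega> x \<subseteq> {w. v \<bullet> w \<le> 0}"
  proof
    fix w assume "w \<in> feasible_directions \<Omega> x"
    then obtain l where "l > 0" "x + l *\<^sub>R w \<in> \<Omega>"
      by (auto simp: feasible_directions_def)
    then have "l * (v \<bullet> w) \<le> 0"
      using normal[of "x + l *\<^sub>R w"] by simp
    then show "w \<in> {w. v \<bullet> w \<le> 0}"
      using \<open>l > 0\<close> by (simp add: mult_le_0_iff)
  qed
  then have "?T \<subseteq> {w. v \<bullet> w \<le> 0}"
    unfolding tangent_cone_def by (rule closure_minimal) (rule closed_halfspace_le)
  moreover have "?P \<in> ?T"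
    using T by (intro closest_point_in_set) (auto simp: convex_cone_def)
  ultimately have "v \<bullet> ?P \<le> 0"
    by auto
  then have "?P \<bullet> ?P \<le> (g - v) \<bullet> ?P"
    using closest_point_convex_cone(1)[OF T, of g] by (simp add: inner_diff_left)
  also have "\<dots> \<le> norm (g - v) * norm ?P"
    by (rule norm_cauchy_schwarz)
  finally have "norm ?P * norm ?P \<le> norm (g - v) * norm ?P"
    by (simp add: power2_norm_eq_inner[symmetric] power2_eq_square)
  then have "norm ?P \<le> norm (g - v)"
    by (cases "?P = 0") auto
  then show ?thesis
    by (simp add: proj_norm_def)
qed

lemma stationaryI:
  fixes \<Omega> :: "'a::euclidean_space set"
  assumes "convex \<Omega>" "p \<in> \<Omega>" and "\<And>z. z \<in> \<Omega> \<Longrightarrow> - gradient f p \<bullet> (z - p) \<le> 0"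
  shows "stationary \<Omega> f p"
  using proj_norm_le_dist_normal[OF assms(1,2), of "- gradient f p" "- gradient f p"] assms(2,3)
  by (auto simp: stationary_def proj_norm_def)

section \<open>The descent lemma and the angle condition\<close>

lemma C1_on_continuous_on: "C1_on \<Omega> f \<Longrightarrow> continuous_on \<Omega> f"
  unfolding C1_on_def
  by (intro continuous_at_imp_continuous_on ballI differentiable_imp_continuous_within) blast

lemma C1_on_GDERIV: "C1_on \<Omega> f \<Longrightarrow> z \<in> \<Omega> \<Longrightarrow> GDERIV f z :> gradient f z"
  unfolding C1_on_def by (blast intro: GDERIV_gradient)

text \<open>Along the segment, the difference between \<open>f\<close> and its quadratic upper model at \<open>y\<close> has
  nonpositive derivative, by the Lipschitz bound on the gradient.\<close>

lemma descent_lemma: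
  fixes f :: "'a::euclidean_space \<Rightarrow> real"
  assumes cv: "convex \<Omega>" and C1: "C1_on \<Omega> f" and lip: "L-lipschitz_on \<Omega> (gradient f)"
    and y: "y \<in> \<Omega>" "y + h \<in> \<Omega>"
  shows "f (y + h) \<le> f y + gradient f y \<bullet> h + L / 2 * (norm h)\<^sup>2"
proof -
  let ?\<phi> = "\<lambda>t. f (y + t *\<^sub>R h) - t * (gradient f y \<bullet> h) - L / 2 * t\<^sup>2 * (norm h)\<^sup>2"
  have "?\<phi> 1 \<le> ?\<phi> 0"
  proof (rule DERIV_nonpos_imp_nonincreasing[where f = ?\<phi>])
    fix t :: real assume t: "0 \<le> t" "t \<le> 1"
    have seg: "y + t *\<^sub>R h \<in> \<Omega>"
      using convexD[OF cv y, of "1 - t" t] t by (simp add: algebra_simps)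
    have "(f has_derivative (\<lambda>v. v \<bullet> gradient f (y + t *\<^sub>R h))) (at (y + t *\<^sub>R h))"
      using C1_on_GDERIV[OF C1 seg] by (simp add: gderiv_def)
    then have "((\<lambda>t. f (y + t *\<^sub>R h)) has_derivative
        (\<lambda>s. (s *\<^sub>R h) \<bullet> gradient f (y + t *\<^sub>R h))) (at t)"
      by (rule has_derivative_compose[rotated]) (auto intro!: derivative_eq_intros)
    then have "((\<lambda>t. f (y + t *\<^sub>R h)) has_real_derivative gradient f (y + t *\<^sub>R h) \<bullet> h) (at t)"
      by (rule has_derivative_imp_has_field_derivative) (simp add: inner_commute)
    then have deriv: "(?\<phi> has_real_derivative
        gradient f (y + t *\<^sub>R h) \<bullet> h - gradient f y \<bullet> h - L * t * (norm h)\<^sup>2) (at t)"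
      by (auto intro!: derivative_eq_intros)
    have "(gradient f (y + t *\<^sub>R h) - gradient f y) \<bullet> h
        \<le> norm (gradient f (y + t *\<^sub>R h) - gradient f y) * norm h"
      by (rule norm_cauchy_schwarz)
    also have "\<dots> \<le> (L * (t * norm h)) * norm h"
      using lipschitz_onD[OF lip seg y(1)] t
      by (intro mult_right_mono) (auto simp: dist_norm)
    finally have "gradient f (y + t *\<^sub>R h) \<bullet> h - gradient f y \<bullet> h - L * t * (norm h)\<^sup>2 \<le> 0"
      by (simp add: inner_diff_left power2_eq_square algebra_simps)
    with deriv show "\<exists>D. (?\<phi> has_real_derivative D) (at t) \<and> D \<le> 0"
      by blast
  qed simp
  then show ?thesis
    by simp
qed

lemma direction_method_props:
  assumes "direction_method \<Omega> \<A>" "x \<in> \<Omega>" "d \<in> \<A> x g"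
  shows "0 \<le> g \<bullet> d" and "proj_norm \<Omega> x g \<noteq> 0 \<Longrightarrow> 0 < g \<bullet> d"
proof -
  have "\<A> x g \<subseteq> (tangent_cone \<Omega> x \<inter> {d. g \<bullet> d > 0}) \<union> {0}"
    and zero: "proj_norm \<Omega> x g \<noteq> 0 \<Longrightarrow> 0 \<notin> \<A> x g"
    using assms(1,2) by (simp_all add: direction_method_def)
  then have cases: "0 < g \<bullet> d \<or> d = 0"
    using assms(3) by blast
  then show "0 \<le> g \<bullet> d"
    by auto
  show "0 < g \<bullet> d" if "proj_norm \<Omega> x g \<noteq> 0"
    using cases zero[OF that] assms(3) by blast
qed

text \<open>The infima defining \<open>SB\<close> and \<open>DSB\<close> are real infima, and are lower bounds only because the
  quotients are nonnegative. Multiplying out the quotient also covers the case of a vanishing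
  projection.\<close>

lemma SB_angle:
  assumes dm: "direction_method \<Omega> \<A>" and x: "x \<in> \<Omega>" and d: "d \<in> \<A> x g"
  shows "SB \<A> \<Omega> * (proj_norm \<Omega> x g * norm d) \<le> g \<bullet> d"
proof (cases "proj_norm \<Omega> x g = 0")
  case True
  then show ?thesis
    using direction_method_props(1)[OF dm x d] by simp
next
  case False
  have ratio: "0 \<le> (h \<bullet> e) / (proj_norm \<Omega> y h * norm e)" if "y \<in> \<Omega>" "e \<in> \<A> y h" for y h e
    using direction_method_props(1)[OF dm that] by (simp add: proj_norm_def)
  have "0 \<le> DSB \<A> \<Omega> y h" if "y \<in> \<Omega>" for y h
  proof (cases "proj_norm \<Omega> y h = 0")
    case False
    then have "\<A> y h \<noteq> {}"
      using dm that by (auto simp: direction_method_def)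
    then show ?thesis
      using ratio[OF that] by (auto simp: DSB_def intro!: cINF_greatest)
  qed (simp add: DSB_def)
  then have "bdd_below ((\<lambda>(y, h). DSB \<A> \<Omega> y h) ` (\<Omega> \<times> UNIV))"
    by (auto intro!: bdd_belowI[of _ 0])
  then have "SB \<A> \<Omega> \<le> DSB \<A> \<Omega> x g"
    unfolding SB_def using x by (auto intro: cINF_lower2[of _ _ "(x, g)"])
  also have "\<dots> = (INF e\<in>\<A> x g. (g \<bullet> e) / (proj_norm \<Omega> x g * norm e))"
    using False by (simp add: DSB_def)
  also have "\<dots> \<le> (g \<bullet> d) / (proj_norm \<Omega> x g * norm d)"
    using ratio[OF x] d by (intro cINF_lower bdd_belowI[of _ 0]) auto
  finally have "SB \<A> \<Omega> \<le> (g \<bullet> d) / (proj_norm \<Omega> x g * norm d)" .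
  moreover have "d \<noteq> 0"
    using direction_method_props(2)[OF dm x d False] by auto
  then have "proj_norm \<Omega> x g * norm d > 0"
    using False by (simp add: proj_norm_def)
  ultimately show ?thesis
    using pos_le_divide_eq by blast
qed

section \<open>Bounded gaps and geometric decay\<close>

lemma bounded_gaps_window:
  assumes "bounded_gaps S"
  obtains C where "\<And>n. \<exists>m\<in>S. n \<le> m \<and> m \<le> n + C"
proof -
  obtain B where inf: "infinite S" and B: "\<And>j. enumerate S (Suc j) - enumerate S j \<le> B"
    using assms by (auto simp: bounded_gaps_def)
  \<comment> \<open>The gap bound says nothing about the stretch before the first element of the set.\<close>
  let ?C = "max (enumerate S 0) B"
  have "\<exists>m\<in>S. n \<le> m \<and> m \<le> n + ?C" for n
  proof (induction n)
    case 0
    then show ?case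
      using enumerate_in_set[OF inf, of 0] by (auto intro!: bexI[of _ "enumerate S 0"])
  next
    case (Suc n)
    then obtain m where m: "m \<in> S" "n \<le> m" "m \<le> n + ?C"
      by blast
    show ?case
    proof (cases "m = n")
      case False
      then show ?thesis
        using m by (intro bexI[of _ m]) auto
    next
      case True
      then obtain j where j: "enumerate S j = n"
        using enumerate_Ex[OF inf m(1)] by auto
      have "n < enumerate S (Suc j)" "enumerate S (Suc j) \<le> n + B"
        using enumerate_step[OF inf, of j] B[of j] j by auto
      then show ?thesis
        using enumerate_in_set[OF inf, of "Suc j"]
        by (intro bexI[of _ "enumerate S (Suc j)"]) auto
    qed
  qed
  then show thesis
    by (rule that)
qed

lemma geometric_decay_at_marked_steps:
  fixes e :: "nat \<Rightarrow> real" and q :: real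
  assumes q: "0 < q" "q \<le> 1" and pos: "\<And>k. 0 < e k" and dec: "\<And>k. e (Suc k) \<le> e k"
    and contr: "\<And>k. K \<le> k \<Longrightarrow> G k \<Longrightarrow> e (Suc k) \<le> q * e k"
  shows "\<exists>M>0. \<forall>k. e k \<le> M * q ^ card {i. i < k \<and> G i}"
proof -
  have card_Suc: "card {i. i < Suc k \<and> G i} = card {i. i < k \<and> G i} + (if G k then 1 else 0)" for k
  proof -
    have "{i. i < Suc k \<and> G i} = (if G k then insert k {i. i < k \<and> G i} else {i. i < k \<and> G i})"
      by (auto simp: less_Suc_eq)
    then show ?thesis
      by simp
  qed
  \<comment> \<open>Dividing by \<open>q ^ K\<close> absorbs the marked steps before \<open>K\<close>, at which nothing is contracted.\<close>
  let ?M = "e 0 / q ^ K"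
  have "e k \<le> ?M * q ^ card {i. i < k \<and> G i}" for k
  proof (induction k)
    case 0
    have "e 0 * q ^ K \<le> e 0 * 1"
      using pos[of 0] q by (intro mult_left_mono power_le_one) auto
    then show ?case
      using q by (simp add: pos_le_divide_eq)
  next
    case (Suc k)
    show ?case
    proof (cases "K \<le> k \<and> G k")
      case True
      then have "e (Suc k) \<le> q * e k"
        by (simp add: contr)
      also have "\<dots> \<le> q * (?M * q ^ card {i. i < k \<and> G i})"
        using Suc q by (intro mult_left_mono) auto
      finally show ?thesis
        using True by (simp add: card_Suc mult_ac)
    next
      case False
      show ?thesis
      proof (cases "G k")
        case True
        then have "k < K"
          using False by simp
        have "card {i. i < Suc k \<and> G i} \<le> card {..k}"
          by (intro card_mono) auto
        then have "q ^ K \<le> q ^ card {i. i < Suc k \<and> G i}"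
          using q \<open>k < K\<close> by (intro power_decreasing) auto
        then have "e 0 \<le> ?M * q ^ card {i. i < Suc k \<and> G i}"
          using pos[of 0] q by (simp add: field_simps)
        moreover have "e (Suc k) \<le> e 0"
          by (rule lift_Suc_antimono_le[of e]) (auto intro: dec)
        ultimately show ?thesis
          by linarith
      next
        case False
        then show ?thesis
          using Suc dec[of k] by (simp add: card_Suc)
      qed
    qed
  qed
  moreover have "?M > 0"
    using pos[of 0] q by simp
  ultimately show ?thesis
    by blast
qed

section \<open>Decrease along a run\<close>

locale short_step_run =
  fixes \<Omega> :: "'a::euclidean_space set"
    and f :: "'a \<Rightarrow> real"
    and \<A> :: "'a \<Rightarrow> 'a \<Rightarrow> 'a set"
    and L \<tau> :: real
    and x d :: "nat \<Rightarrow> 'a"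
    and \<alpha> amax :: "nat \<Rightarrow> real"
  assumes compact_\<Omega>: "compact \<Omega>" and convex_\<Omega>: "convex \<Omega>"
    and C1: "C1_on \<Omega> f"
    and L_pos: "L > 0" and lip: "L-lipschitz_on \<Omega> (gradient f)"
    and dir_method: "direction_method \<Omega> \<A>"
    and SB_eq: "SB \<A> \<Omega> = \<tau>" and \<tau>_pos: "\<tau> > 0"
    and run: "first_order_run \<Omega> f \<A> x d \<alpha> amax"
    and stepsize: "\<And>k. \<alpha> k = min (step_bar f L (x k) (d k)) (amax k)"
    and gaps: "bounded_gaps {k. good_step \<Omega> f L x d \<alpha> k}"
begin

abbreviation residual :: "'a \<Rightarrow> real" where
  "residual z \<equiv> proj_norm \<Omega> z (- gradient f z)"

lemma residual_nonneg: "0 \<le> residual z"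
  by (simp add: proj_norm_def)

lemma run_props:
  shows run_direction: "d k \<in> \<A> (x k) (- gradient f (x k))"
    and amax_pos: "amax k > 0"
    and run_segment: "0 \<le> a \<Longrightarrow> a \<le> amax k \<Longrightarrow> x k + a *\<^sub>R d k \<in> \<Omega>"
    and run_step: "x (Suc k) = x k + \<alpha> k *\<^sub>R d k"
  using run unfolding first_order_run_def by (blast, blast, simp, blast)

text \<open>Stepsize zero is admissible, so an iterate lies in \<open>\<Omega>\<close> by the condition on its own step.\<close>

lemma iterate_mem: "x k \<in> \<Omega>"
  using run_segment[of 0 k] amax_pos[of k] by simp

lemma inner_direction_pos: "0 < - gradient f (x k) \<bullet> d k"
proof -
  have "residual (x k) \<noteq> 0"
    using run iterate_mem[of k] by (auto simp: first_order_run_def stationary_def)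
  then show ?thesis
    by (rule direction_method_props(2)[OF dir_method iterate_mem run_direction])
qed

lemma norm_direction_pos: "0 < norm (d k)"
proof -
  have "d k \<noteq> 0"
  proof
    assume "d k = 0"
    then show False
      using inner_direction_pos[of k] by simp
  qed
  then show ?thesis
    by simp
qed

lemma stepsize_pos: "0 < \<alpha> k"
proof -
  have "0 < step_bar f L (x k) (d k)"
    unfolding step_bar_def using inner_direction_pos[of k] norm_direction_pos[of k] L_pos
    by (intro divide_pos_pos mult_pos_pos zero_less_power)
  then show ?thesis
    using amax_pos[of k] by (simp add: stepsize[of k])
qed

lemma stepsize_short: "\<alpha> k * (L * (norm (d k))\<^sup>2) \<le> - gradient f (x k) \<bullet> d k"
proof -
  have "\<alpha> k \<le> step_bar f L (x k) (d k)"
    by (simp add: stepsize[of k])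
  moreover have "0 < L * (norm (d k))\<^sup>2"
    using L_pos norm_direction_pos[of k] by simp
  ultimately show ?thesis
    by (simp add: step_bar_def pos_le_divide_eq del: inner_minus_left)
qed

lemma decrease_ge_inner: "\<alpha> k / 2 * (- gradient f (x k) \<bullet> d k) \<le> f (x k) - f (x (Suc k))"
proof -
  have "f (x (Suc k)) \<le> f (x k) + gradient f (x k) \<bullet> (\<alpha> k *\<^sub>R d k)
      + L / 2 * (norm (\<alpha> k *\<^sub>R d k))\<^sup>2"
    using descent_lemma[OF convex_\<Omega> C1 lip iterate_mem[of k], of "\<alpha> k *\<^sub>R d k"] iterate_mem[of "Suc k"]
    by (simp add: run_step)
  moreover have "\<alpha> k * (\<alpha> k * (L * (norm (d k))\<^sup>2)) \<le> \<alpha> k * (- gradient f (x k) \<bullet> d k)"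
    using stepsize_short[of k] stepsize_pos[of k] by (intro mult_left_mono) auto
  ultimately show ?thesis
    by (simp add: power2_eq_square algebra_simps)
qed

lemma decrease_ge_displacement:
  "L / 2 * (norm (x (Suc k) - x k))\<^sup>2 \<le> f (x k) - f (x (Suc k))"
proof -
  have "\<alpha> k / 2 * (\<alpha> k * (L * (norm (d k))\<^sup>2)) \<le> \<alpha> k / 2 * (- gradient f (x k) \<bullet> d k)"
    using stepsize_short[of k] stepsize_pos[of k] by (intro mult_left_mono) auto
  then show ?thesis
    using decrease_ge_inner[of k] by (simp add: run_step power2_eq_square algebra_simps)
qed

lemma objective_decreasing: "f (x (Suc k)) < f (x k)"
proof -
  have "0 < \<alpha> k / 2 * (- gradient f (x k) \<bullet> d k)"
    using stepsize_pos[of k] inner_direction_pos[of k] by (intro mult_pos_pos) auto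
  then show ?thesis
    using decrease_ge_inner[of k] by linarith
qed

lemma objective_antimono: "m \<le> n \<Longrightarrow> f (x n) \<le> f (x m)"
  by (rule lift_Suc_antimono_le[of "\<lambda>k. f (x k)"]) (auto intro: less_imp_le objective_decreasing)

text \<open>On a good step the residual is controlled at the starting point or, for a full Frank-Wolfe
  step, at the endpoint, where the negative gradient at the starting point is normal to \<open>\<Omega>\<close>.\<close>

lemma good_step_decrease:
  assumes "good_step \<Omega> f L x d \<alpha> k"
  shows "\<tau>\<^sup>2 * (residual (x k))\<^sup>2 / (2 * L) \<le> f (x k) - f (x (Suc k)) \<or>
         (residual (x (Suc k)))\<^sup>2 / (2 * L) \<le> f (x k) - f (x (Suc k))"
  using assms unfolding good_step_def
proof (elim disjE)
  let ?g = "- gradient f (x k)"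
  assume bar: "\<alpha> k = step_bar f L (x k) (d k)"
  have "\<tau> * (residual (x k) * norm (d k)) \<le> ?g \<bullet> d k"
    using SB_angle[OF dir_method iterate_mem run_direction] by (simp add: SB_eq)
  then have "\<tau> * residual (x k) \<le> (?g \<bullet> d k) / norm (d k)"
    using norm_direction_pos[of k] by (simp add: pos_le_divide_eq mult.assoc del: inner_minus_left)
  then have "(\<tau> * residual (x k))\<^sup>2 \<le> ((?g \<bullet> d k) / norm (d k))\<^sup>2"
    using \<tau>_pos residual_nonneg by (intro power_mono) auto
  then have "(\<tau> * residual (x k))\<^sup>2 / (2 * L) \<le> ((?g \<bullet> d k) / norm (d k))\<^sup>2 / (2 * L)"
    using L_pos by (intro divide_right_mono) auto
  also have "\<dots> = \<alpha> k / 2 * (?g \<bullet> d k)"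
    by (simp add: bar step_bar_def power2_eq_square)
  also have "\<dots> \<le> f (x k) - f (x (Suc k))"
    by (rule decrease_ge_inner)
  finally show ?thesis
    by (simp add: power_mult_distrib)
next
  assume fw: "is_arg_min (\<lambda>y. gradient f (x k) \<bullet> y) (\<lambda>y. y \<in> \<Omega>) (x (Suc k))"
  have "- gradient f (x k) \<bullet> (z - x (Suc k)) \<le> 0" if "z \<in> \<Omega>" for z
    using fw that by (auto simp: is_arg_min_linorder inner_diff_right)
  then have "residual (x (Suc k)) \<le> norm (- gradient f (x (Suc k)) - - gradient f (x k))"
    by (rule proj_norm_le_dist_normal[OF convex_\<Omega> iterate_mem])
  also have "\<dots> = dist (gradient f (x k)) (gradient f (x (Suc k)))"
    by (simp add: dist_norm)
  also have "\<dots> \<le> L * dist (x k) (x (Suc k))"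
    by (rule lipschitz_onD[OF lip iterate_mem iterate_mem])
  finally have "(residual (x (Suc k)))\<^sup>2 \<le> (L * norm (x (Suc k) - x k))\<^sup>2"
    using residual_nonneg by (intro power_mono) (auto simp: dist_norm norm_minus_commute)
  then have "(residual (x (Suc k)))\<^sup>2 / (2 * L) \<le> L / 2 * (norm (x (Suc k) - x k))\<^sup>2"
    using L_pos by (simp add: field_simps power2_eq_square)
  then show ?thesis
    using decrease_ge_displacement[of k] by linarith
qed

section \<open>Stationarity of accumulation points\<close>

lemma objective_convergent:
  obtains fstar where "(\<lambda>k. f (x k)) \<longlonglongrightarrow> fstar" and "\<And>k. fstar < f (x k)"
proof -
  have "bdd_below (f ` \<Omega>)"
    using compact_continuous_image[OF C1_on_continuous_on[OF C1] compact_\<Omega>]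
    by (intro bounded_imp_bdd_below compact_imp_bounded)
  then obtain c where c: "\<And>z. z \<in> \<Omega> \<Longrightarrow> c \<le> f z"
    by (auto simp: bdd_below_def)
  have decseq: "decseq (\<lambda>k. f (x k))"
    using objective_antimono by (auto simp: decseq_def)
  then obtain fstar where lim: "(\<lambda>k. f (x k)) \<longlonglongrightarrow> fstar" and "\<forall>k. fstar \<le> f (x k)"
    using decseq_convergent[of "\<lambda>k. f (x k)" c] c iterate_mem by blast
  then have "fstar < f (x k)" for k
    using objective_decreasing[of k] by (blast intro: order_le_less_trans)
  with lim show thesis
    by (rule that)
qed

lemma decrease_over_window_tendsto: "(\<lambda>k. f (x k) - f (x (k + i))) \<longlonglongrightarrow> 0"
proof -
  obtain fstar where lim: "(\<lambda>k. f (x k)) \<longlonglongrightarrow> fstar"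
    using objective_convergent by blast
  have "(\<lambda>k. f (x k) - f (x (k + i))) \<longlonglongrightarrow> fstar - fstar"
    using lim LIMSEQ_ignore_initial_segment[OF lim, of i] by (rule tendsto_diff)
  then show ?thesis
    by simp
qed

lemma displacement_tendsto: "(\<lambda>k. dist (x (Suc k)) (x k)) \<longlonglongrightarrow> 0"
proof -
  have "(\<lambda>k. 2 / L * (f (x k) - f (x (k + 1)))) \<longlonglongrightarrow> 2 / L * 0"
    by (intro tendsto_mult tendsto_const decrease_over_window_tendsto)
  then have upper: "(\<lambda>k. 2 / L * (f (x k) - f (x (Suc k)))) \<longlonglongrightarrow> 0"
    by simp
  have "(\<lambda>k. (dist (x (Suc k)) (x k))\<^sup>2) \<longlonglongrightarrow> 0"
  proof (rule tendsto_sandwich[OF _ _ tendsto_const upper])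
    show "\<forall>\<^sub>F k in sequentially. (dist (x (Suc k)) (x k))\<^sup>2 \<le> 2 / L * (f (x k) - f (x (Suc k)))"
      using decrease_ge_displacement L_pos by (auto simp: dist_norm field_simps)
  qed simp
  then show ?thesis
    by simp
qed

lemma displacement_over_window_tendsto: "(\<lambda>k. dist (x (k + i)) (x k)) \<longlonglongrightarrow> 0"
proof (induction i)
  case 0
  then show ?case by simp
next
  case (Suc i)
  have "(\<lambda>k. dist (x (Suc (k + i))) (x (k + i)) + dist (x (k + i)) (x k)) \<longlonglongrightarrow> 0 + 0"
    using LIMSEQ_ignore_initial_segment[OF displacement_tendsto, of i] Suc
    by (intro tendsto_add) simp_all
  then have upper: "(\<lambda>k. dist (x (Suc (k + i))) (x (k + i)) + dist (x (k + i)) (x k)) \<longlonglongrightarrow> 0"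
    by simp
  show ?case
    by (rule tendsto_sandwich[OF _ _ tendsto_const upper])
      (auto intro!: always_eventually simp: dist_triangle)
qed

text \<open>The bounded gaps turn good steps, where the residual is controlled, into a full sequence of
  nearby iterates whose residuals vanish; the limit along any subsequence of iterates can then be
  taken along the nearby ones.\<close>

lemma nearby_vanishing_residual:
  obtains j where "(\<lambda>n. dist (x (j n)) (x n)) \<longlonglongrightarrow> 0" and "(\<lambda>n. residual (x (j n))) \<longlonglongrightarrow> 0"
proof -
  obtain C where C: "\<And>n. \<exists>m\<in>{k. good_step \<Omega> f L x d \<alpha> k}. n \<le> m \<and> m \<le> n + C"
    using bounded_gaps_window[OF gaps] by blast
  \<comment> \<open>The smaller of the two constants in the decrease on good steps.\<close>
  define c where "c = min (\<tau>\<^sup>2) 1 / (2 * L)"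
  have c: "0 < c"
    using \<tau>_pos L_pos by (simp add: c_def)
  have "\<exists>i\<le>Suc C. c * (residual (x (n + i)))\<^sup>2 \<le> f (x n) - f (x (n + Suc C))" for n
  proof -
    obtain m where good: "good_step \<Omega> f L x d \<alpha> m" and m: "n \<le> m" "m \<le> n + C"
      using C[of n] by blast
    have dec: "f (x m) - f (x (Suc m)) \<le> f (x n) - f (x (n + Suc C))"
      using objective_antimono[of n m] objective_antimono[of "Suc m" "n + Suc C"] m by simp
    have "c * (residual (x m))\<^sup>2 \<le> \<tau>\<^sup>2 * (residual (x m))\<^sup>2 / (2 * L)"
      "c * (residual (x (Suc m)))\<^sup>2 \<le> (residual (x (Suc m)))\<^sup>2 / (2 * L)"
      using L_pos by (auto simp: c_def intro!: divide_right_mono mult_right_mono mult_left_le_one_le)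
    with good_step_decrease[OF good] dec
    consider "c * (residual (x m))\<^sup>2 \<le> f (x n) - f (x (n + Suc C))"
      | "c * (residual (x (Suc m)))\<^sup>2 \<le> f (x n) - f (x (n + Suc C))"
      by fastforce
    then show ?thesis
    proof cases
      case 1
      then show ?thesis
        using m by (intro exI[of _ "m - n"]) auto
    next
      case 2
      then show ?thesis
        using m by (intro exI[of _ "Suc m - n"]) auto
    qed
  qed
  then obtain i where i: "\<And>n. i n \<le> Suc C"
    and res: "\<And>n. c * (residual (x (n + i n)))\<^sup>2 \<le> f (x n) - f (x (n + Suc C))"
    by metis
  have "(\<lambda>n. \<Sum>l\<le>Suc C. dist (x (n + l)) (x n)) \<longlonglongrightarrow> (\<Sum>l\<le>Suc C. 0)"
    by (intro tendsto_sum displacement_over_window_tendsto)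
  then have upper: "(\<lambda>n. \<Sum>l\<le>Suc C. dist (x (n + l)) (x n)) \<longlonglongrightarrow> 0"
    by simp
  have near: "(\<lambda>n. dist (x (n + i n)) (x n)) \<longlonglongrightarrow> 0"
  proof (rule tendsto_sandwich[OF _ _ tendsto_const upper])
    have "dist (x (n + i n)) (x n) \<le> (\<Sum>l\<le>Suc C. dist (x (n + l)) (x n))" for n
      using i[of n] by (intro member_le_sum[of "i n" _ "\<lambda>l. dist (x (n + l)) (x n)"]) auto
    then show "\<forall>\<^sub>F n in sequentially. dist (x (n + i n)) (x n) \<le> (\<Sum>l\<le>Suc C. dist (x (n + l)) (x n))"
      by simp
  qed simp
  have "(\<lambda>n. inverse c * (f (x n) - f (x (n + Suc C)))) \<longlonglongrightarrow> inverse c * 0"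
    by (intro tendsto_mult tendsto_const decrease_over_window_tendsto)
  then have upper: "(\<lambda>n. inverse c * (f (x n) - f (x (n + Suc C)))) \<longlonglongrightarrow> 0"
    by simp
  have "(\<lambda>n. (residual (x (n + i n)))\<^sup>2) \<longlonglongrightarrow> 0"
  proof (rule tendsto_sandwich[OF _ _ tendsto_const upper])
    show "\<forall>\<^sub>F n in sequentially. (residual (x (n + i n)))\<^sup>2 \<le> inverse c * (f (x n) - f (x (n + Suc C)))"
      using res c by (auto simp: field_simps)
  qed simp
  then have "(\<lambda>n. residual (x (n + i n))) \<longlonglongrightarrow> 0"
    by simp
  with near show thesis
    by (rule that)
qed

lemma accumulation_point_stationary:
  assumes r: "strict_mono (r :: nat \<Rightarrow> nat)" and lim: "(\<lambda>k. x (r k)) \<longlonglongrightarrow> p"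
  shows "stationary \<Omega> f p"
proof (rule stationaryI[OF convex_\<Omega>])
  show p: "p \<in> \<Omega>"
    using closed_sequentially[OF compact_imp_closed[OF compact_\<Omega>] _ lim] iterate_mem by blast
  obtain j where near: "(\<lambda>n. dist (x (j n)) (x n)) \<longlonglongrightarrow> 0"
    and res: "(\<lambda>n. residual (x (j n))) \<longlonglongrightarrow> 0"
    using nearby_vanishing_residual by blast
  let ?y = "\<lambda>k. x (j (r k))"
  have res_r: "(\<lambda>k. residual (?y k)) \<longlonglongrightarrow> 0"
    using LIMSEQ_subseq_LIMSEQ[OF res r] by (simp add: o_def)
  have "(\<lambda>k. ?y k - x (r k)) \<longlonglongrightarrow> 0"
    using LIMSEQ_subseq_LIMSEQ[OF near r] by (simp add: o_def dist_norm tendsto_norm_zero_iff)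
  from tendsto_add[OF this lim] have y: "?y \<longlonglongrightarrow> p"
    by simp
  have "continuous_on \<Omega> (gradient f)"
    using lip by (rule lipschitz_on_continuous_on)
  then have grad: "(\<lambda>k. gradient f (?y k)) \<longlonglongrightarrow> gradient f p"
    by (rule continuous_on_tendsto_compose[OF _ y p]) (simp add: iterate_mem)
  fix z assume z: "z \<in> \<Omega>"
  have "- gradient f p \<bullet> (z - p) \<le> 0 * norm (z - p)"
  proof (rule LIMSEQ_le)
    show "(\<lambda>k. - gradient f (?y k) \<bullet> (z - ?y k)) \<longlonglongrightarrow> - gradient f p \<bullet> (z - p)"
      by (intro tendsto_intros grad y)
    show "(\<lambda>k. residual (?y k) * norm (z - ?y k)) \<longlonglongrightarrow> 0 * norm (z - p)"
      by (intro tendsto_intros res_r y)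
    show "\<exists>N. \<forall>k\<ge>N. - gradient f (?y k) \<bullet> (z - ?y k) \<le> residual (?y k) * norm (z - ?y k)"
      using inner_le_proj_norm[OF convex_\<Omega> iterate_mem diff_mem_tangent_cone[OF z]] by blast
  qed
  then show "- gradient f p \<bullet> (z - p) \<le> 0"
    by simp
qed

section \<open>Convergence rate under the KL condition\<close>

text \<open>The radius in the KL condition depends on the stationary point, and these points may be
  infinitely many; compactness of \<open>\<Omega>\<close> replaces a uniform radius.\<close>

lemma KL_eventually:
  assumes lim: "(\<lambda>k. f (x k)) \<longlonglongrightarrow> fstar" and above: "\<And>k. fstar < f (x k)"
    and KL: "\<And>p. p \<in> \<Omega> \<Longrightarrow> f p = fstar \<Longrightarrow> stationary \<Omega> f p \<Longrightarrow> KL_at \<Omega> f \<mu> p"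
    and \<mu>: "\<mu> > 0"
  shows "\<forall>\<^sub>F k in sequentially. 2 * \<mu> * (f (x k) - fstar) \<le> (residual (x k))\<^sup>2"
proof (rule ccontr)
  assume "\<not> ?thesis"
  then have "\<exists>\<^sub>F k in sequentially. \<not> 2 * \<mu> * (f (x k) - fstar) \<le> (residual (x k))\<^sup>2"
    by (simp add: not_eventually)
  then have "infinite {k. \<not> 2 * \<mu> * (f (x k) - fstar) \<le> (residual (x k))\<^sup>2}"
    by (simp add: cofinite_eq_sequentially[symmetric] frequently_cofinite)
  then obtain r :: "nat \<Rightarrow> nat" where r: "strict_mono r"
    and viol: "\<And>k. \<not> 2 * \<mu> * (f (x (r k)) - fstar) \<le> (residual (x (r k)))\<^sup>2"
    using infinite_enumerate[of "{k. \<not> 2 * \<mu> * (f (x k) - fstar) \<le> (residual (x k))\<^sup>2}"] by blast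
  have "seq_compact \<Omega>"
    using compact_\<Omega> by (rule compact_imp_seq_compact)
  then obtain p s where p: "p \<in> \<Omega>" and s: "strict_mono (s :: nat \<Rightarrow> nat)"
    and xp: "((\<lambda>k. x (r k)) \<circ> s) \<longlonglongrightarrow> p"
    using seq_compactE[of \<Omega> "\<lambda>k. x (r k)"] iterate_mem by blast
  have rs: "strict_mono (\<lambda>k. r (s k))"
    using r s by (simp add: strict_mono_def)
  have xp: "(\<lambda>k. x (r (s k))) \<longlonglongrightarrow> p"
    using xp by (simp add: o_def)
  have flim: "(\<lambda>k. f (x (r (s k)))) \<longlonglongrightarrow> fstar"
    using LIMSEQ_subseq_LIMSEQ[OF lim rs] by (simp add: o_def)
  have "(\<lambda>k. f (x (r (s k)))) \<longlonglongrightarrow> f p"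
    by (rule continuous_on_tendsto_compose[OF C1_on_continuous_on[OF C1] xp p])
      (simp add: iterate_mem)
  then have fp: "f p = fstar"
    using flim by (rule LIMSEQ_unique)
  obtain \<eta> \<delta> where \<eta>: "\<eta> > 0" and \<delta>: "\<delta> > 0"
    and ineq: "\<And>z. z \<in> \<Omega> \<Longrightarrow> norm (z - p) < \<delta> \<Longrightarrow> f p < f z \<Longrightarrow> f z < f p + \<eta> \<Longrightarrow>
      sqrt (2 * \<mu>) * sqrt (f z - f p) \<le> residual z"
    using KL[OF p fp accumulation_point_stationary[OF rs xp]] unfolding KL_at_def by blast
  have "\<forall>\<^sub>F k in sequentially. dist (x (r (s k))) p < \<delta> \<and> f (x (r (s k))) < fstar + \<eta>"
    using tendstoD[OF xp \<delta>] order_tendstoD(2)[OF flim, of "fstar + \<eta>"] \<eta>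
    by (simp add: eventually_conj)
  then obtain k where k: "dist (x (r (s k))) p < \<delta>" "f (x (r (s k))) < fstar + \<eta>"
    by (auto dest: eventually_happens)
  let ?z = "x (r (s k))"
  have "sqrt (2 * \<mu> * (f ?z - fstar)) \<le> residual ?z"
    using ineq[OF iterate_mem, of "r (s k)"] k above[of "r (s k)"]
    by (simp add: fp dist_norm real_sqrt_mult)
  then have "2 * \<mu> * (f ?z - fstar) \<le> (residual ?z)\<^sup>2"
    by (rule sqrt_le_D)
  then show False
    using viol by blast
qed

lemma good_step_contraction:
  assumes good: "good_step \<Omega> f L x d \<alpha> k" and above: "\<And>k. fstar < f (x k)" and \<mu>: "\<mu> > 0"
    and KL: "2 * \<mu> * (f (x k) - fstar) \<le> (residual (x k))\<^sup>2"
    and KL_Suc: "2 * \<mu> * (f (x (Suc k)) - fstar) \<le> (residual (x (Suc k)))\<^sup>2"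
  shows "f (x (Suc k)) - fstar
    \<le> max (inverse (1 + \<mu> / L)) (1 - \<mu> / L * \<tau>\<^sup>2) * (f (x k) - fstar)"
    (is "_ \<le> max ?q1 ?q2 * _")
  using good_step_decrease[OF good]
proof
  assume dec: "\<tau>\<^sup>2 * (residual (x k))\<^sup>2 / (2 * L) \<le> f (x k) - f (x (Suc k))"
  have "\<tau>\<^sup>2 * (2 * \<mu> * (f (x k) - fstar)) / (2 * L) \<le> \<tau>\<^sup>2 * (residual (x k))\<^sup>2 / (2 * L)"
    using KL L_pos by (intro divide_right_mono mult_left_mono) auto
  also have "\<tau>\<^sup>2 * (2 * \<mu> * (f (x k) - fstar)) / (2 * L) = \<mu> / L * \<tau>\<^sup>2 * (f (x k) - fstar)"
    using L_pos by (simp add: field_simps)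
  finally have "\<mu> / L * \<tau>\<^sup>2 * (f (x k) - fstar) \<le> f (x k) - f (x (Suc k))"
    using dec by linarith
  then have "f (x (Suc k)) - fstar \<le> ?q2 * (f (x k) - fstar)"
    by (simp add: left_diff_distrib)
  also have "\<dots> \<le> max ?q1 ?q2 * (f (x k) - fstar)"
    using above[of k] by (intro mult_right_mono) auto
  finally show ?thesis .
next
  assume dec: "(residual (x (Suc k)))\<^sup>2 / (2 * L) \<le> f (x k) - f (x (Suc k))"
  have "2 * \<mu> * (f (x (Suc k)) - fstar) / (2 * L) \<le> (residual (x (Suc k)))\<^sup>2 / (2 * L)"
    using KL_Suc L_pos by (intro divide_right_mono) auto
  with dec have "(1 + \<mu> / L) * (f (x (Suc k)) - fstar) \<le> f (x k) - fstar"
    by (simp add: distrib_right)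
  moreover have "0 < 1 + \<mu> / L"
    using \<mu> L_pos by (simp add: add_pos_pos)
  ultimately have "f (x (Suc k)) - fstar \<le> (f (x k) - fstar) / (1 + \<mu> / L)"
    by (simp add: pos_le_divide_eq mult.commute)
  then have "f (x (Suc k)) - fstar \<le> ?q1 * (f (x k) - fstar)"
    by (simp add: divide_inverse mult.commute)
  also have "\<dots> \<le> max ?q1 ?q2 * (f (x k) - fstar)"
    using above[of k] by (intro mult_right_mono) auto
  finally show ?thesis .
qed

lemma linear_rate:
  assumes lim: "(\<lambda>k. f (x k)) \<longlonglongrightarrow> fstar" and above: "\<And>k. fstar < f (x k)"
    and KL: "\<And>p. p \<in> \<Omega> \<Longrightarrow> f p = fstar \<Longrightarrow> stationary \<Omega> f p \<Longrightarrow> KL_at \<Omega> f \<mu> p"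
    and \<mu>: "\<mu> > 0"
  shows "\<exists>M>0. \<forall>k. f (x k) - fstar \<le>
    M * (max (inverse (1 + \<mu> / L)) (1 - \<mu> / L * \<tau>\<^sup>2)) ^ num_good \<Omega> f L x d \<alpha> k"
  unfolding num_good_def
proof -
  let ?q = "max (inverse (1 + \<mu> / L)) (1 - \<mu> / L * \<tau>\<^sup>2)"
  obtain K where K: "\<And>k. K \<le> k \<Longrightarrow> 2 * \<mu> * (f (x k) - fstar) \<le> (residual (x k))\<^sup>2"
    using KL_eventually[OF lim above KL \<mu>] by (auto simp: eventually_sequentially)
  have ratio: "0 < \<mu> / L"
    using \<mu> L_pos by simp
  then have "0 < inverse (1 + \<mu> / L)" "inverse (1 + \<mu> / L) \<le> 1"
    by (simp_all add: add_pos_pos inverse_le_1_iff)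
  moreover have "0 \<le> \<mu> / L * \<tau>\<^sup>2"
    using ratio by (intro mult_nonneg_nonneg) auto
  ultimately have "0 < ?q" "?q \<le> 1"
    by (auto simp: less_max_iff_disj)
  then show "\<exists>M>0. \<forall>k. f (x k) - fstar \<le> M * ?q ^ card {i. i < k \<and> good_step \<Omega> f L x d \<alpha> i}"
  proof (rule geometric_decay_at_marked_steps[where e = "\<lambda>k. f (x k) - fstar"])
    show "0 < f (x k) - fstar" "f (x (Suc k)) - fstar \<le> f (x k) - fstar" for k
      using above[of k] objective_decreasing[of k] by simp_all
    show "f (x (Suc k)) - fstar \<le> ?q * (f (x k) - fstar)"
      if "K \<le> k" "good_step \<Omega> f L x d \<alpha> k" for k
      using good_step_contraction[OF that(2) above \<mu> K K] that(1) by simp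
  qed
qed

end

theorem proposition3p3:
  fixes \<Omega> :: "'a::euclidean_space set"
    and f :: "'a \<Rightarrow> real"
    and \<A> :: "'a \<Rightarrow> 'a \<Rightarrow> 'a set"
    and L \<tau> :: real
    and x d :: "nat \<Rightarrow> 'a"
    and \<alpha> amax :: "nat \<Rightarrow> real"
  assumes "compact \<Omega>" and "convex \<Omega>"
    and "C1_on \<Omega> f"
    and "L > 0" and "L-lipschitz_on \<Omega> (gradient f)"
    and "direction_method \<Omega> \<A>"
    and "SB \<A> \<Omega> = \<tau>" and "\<tau> > 0"
    and "first_order_run \<Omega> f \<A> x d \<alpha> amax"
    and "\<And>k. \<alpha> k = min (step_bar f L (x k) (d k)) (amax k)"
    and "bounded_gaps {k. good_step \<Omega> f L x d \<alpha> k}"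
  shows "(\<forall>p r. strict_mono (r :: nat \<Rightarrow> nat) \<and> (\<lambda>k. x (r k)) \<longlonglongrightarrow> p \<longrightarrow> stationary \<Omega> f p) \<and>
    (\<forall>k. f (x (Suc k)) < f (x k)) \<and>
    (\<exists>fstar::real. (\<lambda>k. f (x k)) \<longlonglongrightarrow> fstar \<and>
      (\<forall>\<mu>>0. (\<forall>p \<in> {y \<in> \<Omega>. f y = fstar}. stationary \<Omega> f p \<longrightarrow> KL_at \<Omega> f \<mu> p) \<longrightarrow>
        (\<exists>M>0. \<forall>k. f (x k) - fstar \<le>
           M * (max (inverse (1 + \<mu> / L)) (1 - \<mu> / L * \<tau>\<^sup>2)) ^ num_good \<Omega> f L x d \<alpha> k)))"
proof -
  interpret short_step_run \<Omega> f \<A> L \<tau> x d \<alpha> amax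
    using assms by unfold_locales
  obtain fstar where lim: "(\<lambda>k. f (x k)) \<longlonglongrightarrow> fstar" and above: "\<And>k. fstar < f (x k)"
    using objective_convergent by blast
  have "\<exists>M>0. \<forall>k. f (x k) - fstar \<le>
      M * (max (inverse (1 + \<mu> / L)) (1 - \<mu> / L * \<tau>\<^sup>2)) ^ num_good \<Omega> f L x d \<alpha> k"
    if "\<mu> > 0" "\<forall>p \<in> {y \<in> \<Omega>. f y = fstar}. stationary \<Omega> f p \<longrightarrow> KL_at \<Omega> f \<mu> p" for \<mu>
    using linear_rate[OF lim above _ that(1)] that(2) by blast
  with lim show ?thesis
    using accumulation_point_stationary objective_decreasing by blast
qed

end
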